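(* Let $(P,<)$ be a finite poset, $P^*\subset P$ a set of marked elements containing all minimal and maximal elements of $(P,<)$, and $\lambda\in\mathbb Z^{P^*}$ a dominant marking. Let $<'$ be an order on $P$ such that (i) $<'$ is weaker than $<$; (ii) $\mathcal J(P,<)$ is closed under $*_{P,<'}$; (iii) $p\not<'q$ for any $p\in P^*$ and $q\in P$. Then the polytope $\mathcal R_\lambda(P,<,<')$ is normal.
   Context: $\mathcal J=\mathcal J(P,<)$ is the set of order ideals (lower sets). $<'$ is weaker than $<$ if $p<'q$ implies $p<q$. $\max_{<'}A$ is the set of $<'$-maximal elements of $A$; $\mathbf 1_A$ the indicator vector. $J_1*_{P,<'}J_2$ is the order ideal of $(P,<')$ generated by $(J_1\cap J_2)\cap(\max_{<'}J_1\cup\max_{<'}J_2)$. A marking $\lambda\in\mathbb Z^{P^*}$ is dominant if $\lambda_p\ge\lambda_q$ for $p<q$ in $P^*$. Marked relative poset polytope: for $K\in\mathcal J(P^*,<)$ put $\omega_K=\mathbf 1_K\in\mathbb R^{P^*}$ and let $\mathcal R_{\omega_K}(P,<,<')\subset\mathbb R^P$ be the convex hull of $\mathbf 1_{\max_{<'}J}$ over $J\in\mathcal J$ with $J\cap P^*=K$. If $\lambda$ is dominant with nonnegative coordinates there is a unique expression $\lambda=\sum_K\alpha_K(\lambda)\omega_K$ with $\alpha_K(\lambda)\in\mathbb Z_{\ge0}$, $\alpha_\varnothing(\lambda)=0$ and $\{K:\alpha_K(\lambda)>0\}$ a chain under inclusion; then $\mathcal R_\lambda(P,<,<')$ is the Minkowski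 sum $\sum_K\alpha_K(\lambda)\mathcal R_{\omega_K}(P,<,<')$. In general $\mathcal R_\lambda(P,<,<')=\mathcal R_{\lambda+\beta\omega_{P^*}}(P,<,<')-\beta\mathbf 1_{\max_{<'}P}$ for any integer $\beta$ making $\lambda+\beta\omega_{P^*}$ nonnegative (independent of $\beta$). A lattice polytope $Q$ is normal if for every integer $k>0$ every integer point of $kQ$ is a sum of $k$ (not necessarily distinct) integer points of $Q$. *)

theory Defs
  imports "HOL-Analysis.Analysis"
begin

text \<open>
  The finite poset \<open>(P, <)\<close> lives on a finite type \<open>'p\<close>, so that \<open>\<real>\<^sup>P\<close> is \<open>real ^ 'p\<close>. Strict orders are
  relations \<open>lt\<close>, \<open>lt'\<close>, and \<open>Ps\<close> is the set of marked elements. A marking is a function on the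
  whole type, of which only the values on \<open>Ps\<close> are ever used.
\<close>

definition order_ideals :: "('a \<Rightarrow> 'a \<Rightarrow> bool) \<Rightarrow> 'a set \<Rightarrow> 'a set set" where
  "order_ideals lt A = {J. J \<subseteq> A \<and> (\<forall>q\<in>J. \<forall>p\<in>A. lt p q \<longrightarrow> p \<in> J)}"

definition maximal_elements :: "('a \<Rightarrow> 'a \<Rightarrow> bool) \<Rightarrow> 'a set \<Rightarrow> 'a set" where
  "maximal_elements lt A = {p \<in> A. \<not> (\<exists>q\<in>A. lt p q)}"

definition ideal_star :: "('a \<Rightarrow> 'a \<Rightarrow> bool) \<Rightarrow> 'a set \<Rightarrow> 'a set \<Rightarrow> 'a set" where
  "ideal_star lt' J1 J2 =
     (\<lambda>J. J \<in> order_ideals lt' UNIV) hull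
       ((J1 \<inter> J2) \<inter> (maximal_elements lt' J1 \<union> maximal_elements lt' J2))"

definition dominant :: "('a \<Rightarrow> 'a \<Rightarrow> bool) \<Rightarrow> 'a set \<Rightarrow> ('a \<Rightarrow> int) \<Rightarrow> bool" where
  "dominant lt Ps lam \<longleftrightarrow> (\<forall>p\<in>Ps. \<forall>q\<in>Ps. lt p q \<longrightarrow> lam p \<ge> lam q)"

definition indicator_vec :: "'p::finite set \<Rightarrow> real ^ 'p" where
  "indicator_vec A = (\<chi> p. indicator A p)"

definition fundamental_polytope ::
  "('p::finite \<Rightarrow> 'p \<Rightarrow> bool) \<Rightarrow> ('p \<Rightarrow> 'p \<Rightarrow> bool) \<Rightarrow> 'p set \<Rightarrow> 'p set \<Rightarrow> (real ^ 'p) set" where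
  "fundamental_polytope lt lt' Ps K =
     convex hull {indicator_vec (maximal_elements lt' J) | J. J \<in> order_ideals lt UNIV \<and> J \<inter> Ps = K}"

definition is_chain_expansion ::
  "('p::finite \<Rightarrow> 'p \<Rightarrow> bool) \<Rightarrow> 'p set \<Rightarrow> ('p \<Rightarrow> int) \<Rightarrow> ('p set \<Rightarrow> nat) \<Rightarrow> bool" where
  "is_chain_expansion lt Ps lam \<alpha> \<longleftrightarrow>
     {K. \<alpha> K > 0} \<subseteq> order_ideals lt Ps \<and> \<alpha> {} = 0 \<and> chain\<^sub>\<subseteq> {K. \<alpha> K > 0} \<and>
     (\<forall>p\<in>Ps. lam p = (\<Sum>K\<in>order_ideals lt Ps. int (\<alpha> K) * indicator K p))"

text \<open>Meaningful for dominant nonnegative markings; see \<open>chain_expansion_ex1\<close> below.\<close>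

definition chain_coeff ::
  "('p::finite \<Rightarrow> 'p \<Rightarrow> bool) \<Rightarrow> 'p set \<Rightarrow> ('p \<Rightarrow> int) \<Rightarrow> 'p set \<Rightarrow> nat" where
  "chain_coeff lt Ps lam = (THE \<alpha>. is_chain_expansion lt Ps lam \<alpha>)"

text \<open>The outer sum is the Minkowski sum of sets.\<close>

definition nonneg_relative_polytope ::
  "('p::finite \<Rightarrow> 'p \<Rightarrow> bool) \<Rightarrow> ('p \<Rightarrow> 'p \<Rightarrow> bool) \<Rightarrow> 'p set \<Rightarrow> ('p \<Rightarrow> int) \<Rightarrow> (real ^ 'p) set" where
  "nonneg_relative_polytope lt lt' Ps lam =
     (\<Sum>K\<in>order_ideals lt Ps.
        (\<lambda>x. real (chain_coeff lt Ps lam K) *\<^sub>R x) ` fundamental_polytope lt lt' Ps K)"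

text \<open>The choice of the shift \<open>\<beta>\<close> is irrelevant; see \<open>relative_polytope_eq\<close> below.\<close>

definition relative_polytope ::
  "('p::finite \<Rightarrow> 'p \<Rightarrow> bool) \<Rightarrow> ('p \<Rightarrow> 'p \<Rightarrow> bool) \<Rightarrow> 'p set \<Rightarrow> ('p \<Rightarrow> int) \<Rightarrow> (real ^ 'p) set" where
  "relative_polytope lt lt' Ps lam =
     (let \<beta> = (SOME \<beta>. \<forall>p\<in>Ps. lam p + \<beta> \<ge> 0)
      in (\<lambda>x. x - of_int \<beta> *\<^sub>R indicator_vec (maximal_elements lt' UNIV)) `
           nonneg_relative_polytope lt lt' Ps (\<lambda>p. lam p + \<beta>))"

definition integer_points :: "(real ^ 'p) set" where
  "integer_points = {x. \<forall>i. x $ i \<in> \<int>}"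

definition lattice_polytope :: "(real ^ 'p) set \<Rightarrow> bool" where
  "lattice_polytope Q \<longleftrightarrow> (\<exists>V. finite V \<and> V \<subseteq> integer_points \<and> Q = convex hull V)"

definition normal_polytope :: "(real ^ 'p::finite) set \<Rightarrow> bool" where
  "normal_polytope Q \<longleftrightarrow> lattice_polytope Q \<and>
     (\<forall>k::nat. k > 0 \<longrightarrow>
       (\<forall>x \<in> ((*\<^sub>R) (real k) ` Q) \<inter> integer_points.
         \<exists>y. (\<forall>i<k. y i \<in> Q \<inter> integer_points) \<and> x = (\<Sum>i<k. y i)))"


subsection \<open>The definitions do not depend on choices\<close>

lemma chain_expansion_pos_set:
  assumes "is_chain_expansion lt Ps lam \<alpha>" and "\<alpha> K0 > 0"
  defines "S \<equiv> {p\<in>Ps. lam p > 0}"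
  shows "\<alpha> S > 0" and "\<And>K. \<alpha> K > 0 \<Longrightarrow> K \<subseteq> S"
proof -
  let ?C = "{K. \<alpha> K > 0}"
  have C: "?C \<subseteq> order_ideals lt Ps" and ch: "chain\<^sub>\<subseteq> ?C"
    and lam: "\<And>p. p \<in> Ps \<Longrightarrow> lam p = (\<Sum>K\<in>order_ideals lt Ps. int (\<alpha> K) * indicator K p)"
    using assms(1) unfolding is_chain_expansion_def by auto
  have pos: "lam p > 0 \<longleftrightarrow> (\<exists>K. \<alpha> K > 0 \<and> p \<in> K)" if "p \<in> Ps" for p
  proof -
    have "(\<Sum>K\<in>order_ideals lt Ps. int (\<alpha> K) * indicator K p) \<ge> 0"
      by (intro sum_nonneg) auto
    moreover have "(\<Sum>K\<in>order_ideals lt Ps. int (\<alpha> K) * indicator K p) = 0 \<longleftrightarrow>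
        (\<forall>K\<in>order_ideals lt Ps. int (\<alpha> K) * indicator K p = 0)"
      by (rule sum_nonneg_eq_0_iff) auto
    ultimately have "lam p > 0 \<longleftrightarrow> (\<exists>K\<in>order_ideals lt Ps. int (\<alpha> K) * indicator K p \<noteq> 0)"
      unfolding lam[OF that] by (metis (no_types, lifting) less_le)
    also have "\<dots> \<longleftrightarrow> (\<exists>K\<in>order_ideals lt Ps. \<alpha> K > 0 \<and> p \<in> K)"
      by (intro bex_cong refl) (simp add: indicator_def)
    finally show ?thesis using C by blast
  qed
  have sub: "K \<subseteq> Ps" if "\<alpha> K > 0" for K
    using C that by (auto simp: order_ideals_def)
  show le: "K \<subseteq> S" if "\<alpha> K > 0" for K
    using sub[OF that] that pos unfolding S_def by auto
  have "\<Union>?C \<in> ?C"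
    using ch assms(2)
    by (intro Union_in_chain[where \<B> = ?C and \<A> = UNIV])
       (auto simp: chain_subset_def subset_chain_def)
  moreover have "\<Union>?C = S" using le pos unfolding S_def by auto
  ultimately show "\<alpha> S > 0" by simp
qed

lemma chain_expansion_step:
  assumes "is_chain_expansion lt Ps lam \<alpha>" and "\<alpha> S > 0"
  shows "is_chain_expansion lt Ps (\<lambda>p. lam p - indicator S p) (\<alpha>(S := \<alpha> S - 1))"
proof -
  have S: "S \<in> order_ideals lt Ps"
    using assms unfolding is_chain_expansion_def by auto
  have eq1: "(\<Sum>K\<in>order_ideals lt Ps. int ((\<alpha>(S := \<alpha> S - 1)) K) * indicator K p) =
      (\<Sum>K\<in>order_ideals lt Ps. int (\<alpha> K) * indicator K p - (if K = S then indicator S p else 0))"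
    (is "_ = ?r p") for p
    using assms(2) by (intro sum.cong) (auto simp: of_nat_diff algebra_simps)
  have eq2: "?r p = (\<Sum>K\<in>order_ideals lt Ps. int (\<alpha> K) * indicator K p) - indicator S p" for p
    using S by (simp add: sum_subtractf sum.delta)
  have eq: "(\<Sum>K\<in>order_ideals lt Ps. int ((\<alpha>(S := \<alpha> S - 1)) K) * indicator K p) =
      (\<Sum>K\<in>order_ideals lt Ps. int (\<alpha> K) * indicator K p) - indicator S p" for p
    by (rule trans[OF eq1 eq2])
  have sub: "{K. (\<alpha>(S := \<alpha> S - 1)) K > 0} \<subseteq> {K. \<alpha> K > 0}"
    using assms(2) by auto
  have "chain\<^sub>\<subseteq> {K. (\<alpha>(S := \<alpha> S - 1)) K > 0}"
    using assms(1) sub unfolding is_chain_expansion_def chain_subset_def by blast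
  moreover have "{K. (\<alpha>(S := \<alpha> S - 1)) K > 0} \<subseteq> order_ideals lt Ps"
    using sub assms(1) unfolding is_chain_expansion_def by blast
  moreover have "(\<alpha>(S := \<alpha> S - 1)) {} = 0"
    using assms(1) unfolding is_chain_expansion_def by simp
  moreover have "\<forall>p\<in>Ps. lam p = (\<Sum>K\<in>order_ideals lt Ps. int (\<alpha> K) * indicator K p)"
    using assms(1) unfolding is_chain_expansion_def by blast
  ultimately show ?thesis unfolding is_chain_expansion_def eq by simp
qed

lemma chain_expansion_unique:
  assumes "is_chain_expansion lt Ps lam \<alpha>" and "is_chain_expansion lt Ps lam \<alpha>'"
  shows "\<alpha> = \<alpha>'"
  using assms
proof (induction "sum \<alpha> UNIV" arbitrary: lam \<alpha> \<alpha>')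
  case 0
  then have a0: "\<alpha> K = 0" for K by simp
  have "lam p = 0" if "p \<in> Ps" for p
    using 0(2) that a0 unfolding is_chain_expansion_def by simp
  then have "{p\<in>Ps. lam p > 0} = {}" by auto
  moreover have "\<alpha>' {} = 0" using 0(3) unfolding is_chain_expansion_def by auto
  ultimately have "\<alpha>' K = 0" for K
    using chain_expansion_pos_set(1)[OF 0(3), of K] by (metis gr0I less_irrefl)
  with a0 show ?case by auto
next
  case (Suc n)
  define S where "S = {p\<in>Ps. lam p > 0}"
  obtain K where "\<alpha> K > 0"
    using Suc.hyps(2) sum.neutral[of UNIV \<alpha>] by fastforce
  then have aS: "\<alpha> S > 0" unfolding S_def by (rule chain_expansion_pos_set(1)[OF Suc.prems(1)])
  have "S \<noteq> {}" using aS Suc.prems(1) unfolding is_chain_expansion_def by auto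
  then obtain p where "p \<in> Ps" "lam p > 0" unfolding S_def by auto
  have "\<exists>K. \<alpha>' K > 0"
  proof (rule ccontr)
    assume "\<not> (\<exists>K. \<alpha>' K > 0)"
    then have "lam p = 0"
      using Suc.prems(2) \<open>p \<in> Ps\<close> unfolding is_chain_expansion_def by simp
    with \<open>lam p > 0\<close> show False by simp
  qed
  then have aS': "\<alpha>' S > 0" unfolding S_def using chain_expansion_pos_set(1)[OF Suc.prems(2)] by blast
  have "sum \<alpha> UNIV = \<alpha> S + sum \<alpha> (UNIV - {S})" by (simp add: sum.remove)
  moreover have "sum (\<alpha>(S := \<alpha> S - 1)) UNIV = (\<alpha> S - 1) + sum \<alpha> (UNIV - {S})"
    by (subst sum.remove[of UNIV S]) (auto intro!: sum.cong)
  ultimately have "n = sum (\<alpha>(S := \<alpha> S - 1)) UNIV" using Suc.hyps(2) aS by simp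
  from Suc.hyps(1)[OF this chain_expansion_step[OF Suc.prems(1) aS] chain_expansion_step[OF Suc.prems(2) aS']]
  have eq: "\<alpha>(S := \<alpha> S - 1) = \<alpha>'(S := \<alpha>' S - 1)" .
  show ?case
  proof
    fix K
    show "\<alpha> K = \<alpha>' K"
      using fun_cong[OF eq, of K] aS aS' by (cases "K = S") auto
  qed
qed

lemma chain_expansion_add:
  assumes ex: "is_chain_expansion lt Ps lam \<alpha>" and S: "S \<in> order_ideals lt Ps" "S \<noteq> {}"
    and sub: "\<And>K. \<alpha> K > 0 \<Longrightarrow> K \<subseteq> S"
  shows "is_chain_expansion lt Ps (\<lambda>p. lam p + int n * indicator S p) (\<alpha>(S := \<alpha> S + n))"
proof -
  have eq1: "(\<Sum>K\<in>order_ideals lt Ps. int ((\<alpha>(S := \<alpha> S + n)) K) * indicator K p) =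
      (\<Sum>K\<in>order_ideals lt Ps. int (\<alpha> K) * indicator K p + (if K = S then int n * indicator S p else 0))"
    (is "_ = ?r p") for p
    by (intro sum.cong) (auto simp: algebra_simps)
  have eq2: "?r p = (\<Sum>K\<in>order_ideals lt Ps. int (\<alpha> K) * indicator K p) + int n * indicator S p" for p
    using S by (simp add: sum.distrib sum.delta)
  have eq: "(\<Sum>K\<in>order_ideals lt Ps. int ((\<alpha>(S := \<alpha> S + n)) K) * indicator K p) =
      (\<Sum>K\<in>order_ideals lt Ps. int (\<alpha> K) * indicator K p) + int n * indicator S p" for p
    by (rule trans[OF eq1 eq2])
  have sub': "{K. (\<alpha>(S := \<alpha> S + n)) K > 0} \<subseteq> insert S {K. \<alpha> K > 0}"
    by auto
  have chain: "chain\<^sub>\<subseteq> (insert S {K. \<alpha> K > 0})"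
    using ex sub unfolding is_chain_expansion_def chain_subset_def by blast
  have "chain\<^sub>\<subseteq> {K. (\<alpha>(S := \<alpha> S + n)) K > 0}"
    using chain sub' unfolding chain_subset_def by blast
  moreover have "{K. (\<alpha>(S := \<alpha> S + n)) K > 0} \<subseteq> order_ideals lt Ps"
    using sub' S(1) ex unfolding is_chain_expansion_def by blast
  moreover have "(\<alpha>(S := \<alpha> S + n)) {} = 0"
    using S(2) ex unfolding is_chain_expansion_def by simp
  moreover have "\<forall>p\<in>Ps. lam p = (\<Sum>K\<in>order_ideals lt Ps. int (\<alpha> K) * indicator K p)"
    using ex unfolding is_chain_expansion_def by blast
  ultimately show ?thesis unfolding is_chain_expansion_def eq by simp
qed

lemma chain_expansion_exists:
  fixes lt :: "'p::finite \<Rightarrow> 'p \<Rightarrow> bool"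
  assumes "dominant lt Ps lam" and "\<forall>p\<in>Ps. lam p \<ge> 0"
  shows "\<exists>\<alpha>. is_chain_expansion lt Ps lam \<alpha>"
  using assms
proof (induction "nat (sum lam Ps)" arbitrary: lam rule: less_induct)
  case less
  define S where "S = {p\<in>Ps. lam p > 0}"
  have S: "S \<in> order_ideals lt Ps"
    using less.prems unfolding S_def order_ideals_def dominant_def by force
  show ?case
  proof (cases "S = {}")
    case True
    then have "is_chain_expansion lt Ps lam (\<lambda>_. 0)"
      using less.prems(2) unfolding S_def is_chain_expansion_def chain_subset_def
      by (auto simp: order.antisym not_less)
    then show ?thesis by blast
  next
    case False
    let ?l = "\<lambda>p. lam p - indicator S p"
    have nn: "\<forall>p\<in>Ps. ?l p \<ge> 0"
      using less.prems(2) unfolding S_def by (auto simp: indicator_def)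
    have dom: "dominant lt Ps ?l"
      unfolding dominant_def
    proof (intro ballI impI)
      fix p q assume "p \<in> Ps" "q \<in> Ps" "lt p q"
      then have "lam p \<ge> lam q" using less.prems(1) by (auto simp: dominant_def)
      then show "?l p \<ge> ?l q"
        using less.prems(2) \<open>p \<in> Ps\<close> \<open>q \<in> Ps\<close> by (auto simp: S_def indicator_def)
    qed
    have "sum ?l Ps < sum lam Ps"
      using False by (intro sum_strict_mono_ex1) (auto simp: S_def indicator_def)
    then have "nat (sum ?l Ps) < nat (sum lam Ps)"
      using sum_nonneg[of Ps ?l] nn by auto
    from less.hyps[OF this dom nn] obtain \<alpha> where \<alpha>: "is_chain_expansion lt Ps ?l \<alpha>" by blast
    have "K \<subseteq> S" if "\<alpha> K > 0" for K
    proof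
      fix p assume "p \<in> K"
      then have "p \<in> Ps" "?l p > 0" using chain_expansion_pos_set(2)[OF \<alpha> that that] by auto
      moreover have "(0::int) \<le> indicator S p" by (rule indicator_pos_le)
      ultimately have "p \<in> Ps" "lam p > 0" by linarith+
      then show "p \<in> S" by (simp add: S_def)
    qed
    from chain_expansion_add[OF \<alpha> S False this, of 1] show ?thesis by auto
  qed
qed

lemma chain_expansion_ex1:
  assumes "dominant lt Ps lam" and "\<forall>p\<in>Ps. lam p \<ge> 0"
  shows "\<exists>!\<alpha>. is_chain_expansion lt Ps lam \<alpha>"
  using chain_expansion_exists[OF assms] chain_expansion_unique by blast

lemma exists_maximal:
  assumes "irreflp lt" "transp lt" "finite A" "A \<noteq> {}"
  shows "\<exists>m\<in>A. \<forall>x\<in>A. \<not> lt m x"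
proof -
  have "asymp_on A lt"
    by (rule asymp_onI) (meson assms(1,2) irreflpD transpD)
  moreover have "transp_on A lt" by (rule transp_on_subset[OF assms(2)]) simp
  ultimately have "\<exists>m\<in>A. \<forall>x\<in>A. x \<noteq> m \<longrightarrow> \<not> lt m x"
    using Finite_Set.bex_max_element[OF assms(3)] assms(4) by blast
  then show ?thesis using assms(1) by (metis irreflpD)
qed

lemma fundamental_polytope_top:
  fixes lt :: "'p::finite \<Rightarrow> 'p \<Rightarrow> bool"
  assumes "irreflp lt" and "transp lt" and max: "maximal_elements lt UNIV \<subseteq> Ps"
  shows "fundamental_polytope lt lt' Ps Ps = {indicator_vec (maximal_elements lt' UNIV)}"
proof -
  have "J = UNIV" if J: "J \<in> order_ideals lt UNIV" "J \<inter> Ps = Ps" for J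
  proof (rule ccontr)
    assume "J \<noteq> UNIV"
    then have "-J \<noteq> {}" by auto
    from exists_maximal[OF assms(1,2) finite this]
    obtain m where "m \<notin> J" "\<And>x. x \<notin> J \<Longrightarrow> \<not> lt m x" by auto
    then have "m \<in> maximal_elements lt UNIV"
      using J(1) by (auto simp: maximal_elements_def order_ideals_def)
    with max J(2) \<open>m \<notin> J\<close> show False by blast
  qed
  moreover have "UNIV \<in> order_ideals lt UNIV" by (simp add: order_ideals_def)
  ultimately have "{J. J \<in> order_ideals lt UNIV \<and> J \<inter> Ps = Ps} = {UNIV}" by auto
  then have "{indicator_vec (maximal_elements lt' J) | J. J \<in> order_ideals lt UNIV \<and> J \<inter> Ps = Ps} =
      {indicator_vec (maximal_elements lt' UNIV)}"
    by (simp add: setcompr_eq_image)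
  then show ?thesis unfolding fundamental_polytope_def by simp
qed

lemma nonneg_relative_polytope_shift:
  fixes lt lt' :: "'p::finite \<Rightarrow> 'p \<Rightarrow> bool"
  assumes ord: "irreflp lt" "transp lt" "maximal_elements lt UNIV \<subseteq> Ps"
    and lam: "dominant lt Ps lam" "\<forall>p\<in>Ps. lam p \<ge> 0"
  defines "v \<equiv> indicator_vec (maximal_elements lt' UNIV)"
  shows "nonneg_relative_polytope lt lt' Ps (\<lambda>p. lam p + int n) =
    (\<lambda>x. x + real n *\<^sub>R v) ` nonneg_relative_polytope lt lt' Ps lam"
proof -
  define \<alpha> where "\<alpha> = chain_coeff lt Ps lam"
  define \<alpha>' where "\<alpha>' = chain_coeff lt Ps (\<lambda>p. lam p + int n)"
  have \<alpha>: "is_chain_expansion lt Ps lam \<alpha>"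
    unfolding \<alpha>_def chain_coeff_def by (rule theI'[OF chain_expansion_ex1[OF lam]])
  have top: "Ps \<in> order_ideals lt Ps" by (simp add: order_ideals_def)
  have "Ps \<noteq> {}"
    using exists_maximal[OF ord(1,2), of UNIV] ord(3) by (auto simp: maximal_elements_def)
  then have "is_chain_expansion lt Ps (\<lambda>p. lam p + int n * indicator Ps p) (\<alpha>(Ps := \<alpha> Ps + n))"
    using \<alpha> by (intro chain_expansion_add[OF _ top]) (auto simp: is_chain_expansion_def order_ideals_def)
  then have ex': "is_chain_expansion lt Ps (\<lambda>p. lam p + int n) (\<alpha>(Ps := \<alpha> Ps + n))"
    unfolding is_chain_expansion_def by simp
  have \<alpha>': "\<alpha>' = \<alpha>(Ps := \<alpha> Ps + n)"
    unfolding \<alpha>'_def chain_coeff_def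
    by (rule the_equality[where P = "is_chain_expansion lt Ps (\<lambda>p. lam p + int n)"])
       (rule ex', rule chain_expansion_unique[OF _ ex'])
  let ?F = "fundamental_polytope lt lt' Ps"
  let ?R = "\<Sum>K\<in>order_ideals lt Ps - {Ps}. (\<lambda>x. real (\<alpha> K) *\<^sub>R x) ` ?F K"
  have F: "?F Ps = {v}" unfolding v_def by (rule fundamental_polytope_top[OF ord])
  have "nonneg_relative_polytope lt lt' Ps (\<lambda>p. lam p + int n) =
      (\<lambda>x. real (\<alpha>' Ps) *\<^sub>R x) ` ?F Ps +
      (\<Sum>K\<in>order_ideals lt Ps - {Ps}. (\<lambda>x. real (\<alpha>' K) *\<^sub>R x) ` ?F K)"
    unfolding nonneg_relative_polytope_def \<alpha>'_def[symmetric] using top by (simp add: sum.remove)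
  also have "(\<Sum>K\<in>order_ideals lt Ps - {Ps}. (\<lambda>x. real (\<alpha>' K) *\<^sub>R x) ` ?F K) = ?R"
    by (intro sum.cong) (auto simp: \<alpha>')
  also have "(\<lambda>x. real (\<alpha>' Ps) *\<^sub>R x) ` ?F Ps + ?R =
      (\<lambda>x. x + real n *\<^sub>R v) ` ((\<lambda>x. real (\<alpha> Ps) *\<^sub>R x) ` ?F Ps + ?R)"
  proof -
    have "{c + d} + R = (\<lambda>x. x + d) ` ({c} + R)" for c d :: "real ^ 'p" and R
      by (auto simp: set_plus_def image_def ac_simps)
    from this[of "real (\<alpha> Ps) *\<^sub>R v" "real n *\<^sub>R v" ?R]
    show ?thesis unfolding F \<alpha>' by (simp add: scaleR_add_left)
  qed
  also have "(\<lambda>x. real (\<alpha> Ps) *\<^sub>R x) ` ?F Ps + ?R = nonneg_relative_polytope lt lt' Ps lam"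
    unfolding nonneg_relative_polytope_def \<alpha>_def[symmetric] using top by (simp add: sum.remove)
  finally show ?thesis .
qed

lemma relative_polytope_eq:
  fixes lt :: "'p::finite \<Rightarrow> 'p \<Rightarrow> bool"
  assumes ord: "irreflp lt" "transp lt" "maximal_elements lt UNIV \<subseteq> Ps"
    and dom: "dominant lt Ps lam" and \<beta>: "\<forall>p\<in>Ps. lam p + \<beta> \<ge> 0"
  shows "relative_polytope lt lt' Ps lam =
    (\<lambda>x. x - of_int \<beta> *\<^sub>R indicator_vec (maximal_elements lt' UNIV)) `
      nonneg_relative_polytope lt lt' Ps (\<lambda>p. lam p + \<beta>)"
proof -
  define T where "T = (\<lambda>\<beta>::int. (\<lambda>x. x - of_int \<beta> *\<^sub>R indicator_vec (maximal_elements lt' UNIV)) `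
      nonneg_relative_polytope lt lt' Ps (\<lambda>p. lam p + \<beta>))"
  have *: "T b = T c" if b: "\<forall>p\<in>Ps. lam p + b \<ge> 0" and "b \<le> c" for b c
  proof -
    obtain n where n: "c = b + int n" using \<open>b \<le> c\<close> zle_iff_zadd by blast
    have "dominant lt Ps (\<lambda>p. lam p + b)" using dom by (simp add: dominant_def)
    from nonneg_relative_polytope_shift[OF ord this b, of lt' n] show ?thesis
      unfolding T_def n by (simp add: image_image algebra_simps)
  qed
  define b where "b = (SOME \<beta>. \<forall>p\<in>Ps. lam p + \<beta> \<ge> 0)"
  have b: "\<forall>p\<in>Ps. lam p + b \<ge> 0" unfolding b_def by (rule someI) (rule \<beta>)
  have "T b = T \<beta>"
  proof (cases "b \<le> \<beta>")
    case True
    then show ?thesis by (rule *[OF b])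
  next
    case False
    then have "\<beta> \<le> b" by simp
    then show ?thesis by (rule *[OF \<beta>, symmetric])
  qed
  then show ?thesis unfolding relative_polytope_def Let_def T_def b_def .
qed

end

theory Submission
  imports Defs
begin

text \<open>
  Write \<open>m J\<close> for the indicator vector of \<open>max\<^bsub><'\<^esub> J\<close>. Then \<open>m J1 + m J2 = m (J1 \<union> J2) + m (J1 * J2)\<close>, and
  if \<open>J1 \<inter> P* \<subseteq> J2 \<inter> P*\<close>, the two ideals on the right have the same traces on \<open>P*\<close> as those on the left.
  Since \<open>J1 * J2 \<subseteq> J1 \<inter> J2\<close>, the exchange increases \<open>2^|J1| + 2^|J2|\<close> for incomparable ideals, so
  every point of \<open>k R\<close> is a nonnegative real combination of the \<open>m J\<close>, with total weight \<open>k \<alpha>_K\<close> on the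
  ideals of trace \<open>K\<close>, whose support is a chain. For such a combination \<open>x = \<Sum> a_J m J\<close>, the numbers
  \<open>f p = \<Sum> {a_J. p \<in> J}\<close> satisfy \<open>f p = x p + max {f q. p <' q}\<close>. Hence if \<open>x\<close> is integral, then so
  are \<open>f\<close> and all \<open>a_J\<close>, and the resulting multiset of ideals can be divided into \<open>k\<close> parts, each with
  \<open>\<alpha>_K\<close> ideals of trace \<open>K\<close>.
\<close>

section \<open>The star operation and its maximal elements\<close>

lemma ideal_star_eq:
  assumes "transp lt'"
  shows "ideal_star lt' J1 J2 =
    {p. \<exists>g\<in>(J1 \<inter> J2) \<inter> (maximal_elements lt' J1 \<union> maximal_elements lt' J2). p = g \<or> lt' p g}"
    (is "_ = ?R")
  unfolding ideal_star_def
proof (rule hull_unique)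
  show "?R \<in> order_ideals lt' UNIV"
    using transpD[OF assms] unfolding order_ideals_def by blast
next
  fix J
  assume "(J1 \<inter> J2) \<inter> (maximal_elements lt' J1 \<union> maximal_elements lt' J2) \<subseteq> J"
    and "J \<in> order_ideals lt' UNIV"
  then show "?R \<subseteq> J" unfolding order_ideals_def by blast
qed blast

text \<open>The generators form an antichain for \<open>lt'\<close>: an element that lies below some
  element of \<open>J1 \<inter> J2\<close> is maximal in neither \<open>J1\<close> nor
  \<open>J2\<close>. Hence the maximal elements of the generated ideal are exactly its
  generators.\<close>

lemma maximal_elements_ideal_star:
  assumes "transp lt'"
  shows "maximal_elements lt' (ideal_star lt' J1 J2) =
    (J1 \<inter> J2) \<inter> (maximal_elements lt' J1 \<union> maximal_elements lt' J2)"
  using transpD[OF assms]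
  unfolding ideal_star_eq[OF assms] maximal_elements_def by blast

section \<open>Finite weights and linear combinations\<close>

text \<open>Greedy choice: take as much as allowed at one element and leave the rest to the others.
  With \<open>n\<close> read as multiplicities, this picks a submultiset of size
  \<open>s\<close>.\<close>

lemma exists_subweight:
  fixes n :: "'a \<Rightarrow> nat"
  assumes "finite A" and "s \<le> sum n A"
  shows "\<exists>b. (\<forall>x. b x \<le> n x) \<and> sum b A = s"
  using assms
proof (induction A arbitrary: s rule: finite_induct)
  case empty
  then show ?case by (intro exI[of _ "\<lambda>_. 0"]) auto
next
  case (insert x A)
  have "s - min s (n x) \<le> sum n A" using insert by auto
  from insert.IH[OF this] obtain b where b: "\<forall>x. b x \<le> n x" "sum b A = s - min s (n x)" by blast
  have "sum (b(x := min s (n x))) A = sum b A"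
    using insert.hyps by (intro sum.cong) auto
  then show ?case
    using b insert.hyps by (intro exI[of _ "b(x := min s (n x))"]) auto
qed

lemma sum_scaleR_axis:
  fixes g :: "'a::finite \<Rightarrow> 'b::real_vector"
  shows "(\<Sum>J\<in>UNIV. (axis T (1::real)) $ J *\<^sub>R g J) = g T"
proof -
  have "(\<Sum>J\<in>UNIV. (axis T (1::real)) $ J *\<^sub>R g J) = (\<Sum>J\<in>UNIV. if J = T then g J else 0)"
    by (intro sum.cong) (auto simp: axis_def)
  then show ?thesis by simp
qed

text \<open>Kept general in \<open>g\<close> so that one computation covers the represented point,
  the total weight on a trace and the potential \<open>2 ^ card J\<close>.\<close>

lemma sum_exchange:
  fixes g :: "'a::finite \<Rightarrow> 'b::real_vector" and a :: "real ^ 'a"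
  shows "(\<Sum>J\<in>UNIV. (a + e *\<^sub>R (axis A 1 + axis B 1 - axis C 1 - axis D 1)) $ J *\<^sub>R g J) =
    (\<Sum>J\<in>UNIV. a $ J *\<^sub>R g J) + e *\<^sub>R (g A + g B - g C - g D)"
proof -
  have "(a + e *\<^sub>R (axis A 1 + axis B 1 - axis C 1 - axis D 1)) $ J *\<^sub>R g J =
      a $ J *\<^sub>R g J + e *\<^sub>R (axis A (1::real) $ J *\<^sub>R g J + axis B (1::real) $ J *\<^sub>R g J
        - axis C (1::real) $ J *\<^sub>R g J - axis D (1::real) $ J *\<^sub>R g J)" for J
    by (simp add: algebra_simps)
  then show ?thesis
    by (simp add: sum.distrib sum_subtractf scaleR_sum_right[symmetric] sum_scaleR_axis)
qed

text \<open>Weights are indexed by \<open>A\<close> and not by the points of the image, so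
  \<open>f\<close> may repeat values. The points with such weights form a convex set that contains
  the image.\<close>

lemma convex_hull_image_weights:
  fixes f :: "'a \<Rightarrow> 'b::real_vector"
  assumes "finite A" and "x \<in> convex hull (f ` A)"
  shows "\<exists>u. (\<forall>j. 0 \<le> u j) \<and> (\<forall>j. j \<notin> A \<longrightarrow> u j = 0) \<and> sum u A = (1::real) \<and> x = (\<Sum>j\<in>A. u j *\<^sub>R f j)"
proof -
  let ?S = "{x. \<exists>u. (\<forall>j. 0 \<le> u j) \<and> (\<forall>j. j \<notin> A \<longrightarrow> u j = 0) \<and> sum u A = (1::real) \<and> x = (\<Sum>j\<in>A. u j *\<^sub>R f j)}"
  have "convex hull (f ` A) \<subseteq> ?S"
  proof (rule hull_minimal)
    show "f ` A \<subseteq> ?S"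
    proof
      fix y assume "y \<in> f ` A"
      then obtain j where j: "j \<in> A" "y = f j" by blast
      have "(\<Sum>i\<in>A. (if i = j then 1 else 0::real) *\<^sub>R f i) = (\<Sum>i\<in>A. if i = j then f i else 0)"
        by (intro sum.cong) auto
      then show "y \<in> ?S" using j assms(1)
        by (intro CollectI exI[of _ "\<lambda>i. if i = j then 1 else 0"]) auto
    qed
    show "convex ?S"
    proof (rule convexI)
      fix x y and s t :: real
      assume "x \<in> ?S" "y \<in> ?S" and st: "0 \<le> s" "0 \<le> t" "s + t = 1"
      then obtain u v where
        "\<forall>j. 0 \<le> u j" "\<forall>j. j \<notin> A \<longrightarrow> u j = 0" "sum u A = 1" "x = (\<Sum>j\<in>A. u j *\<^sub>R f j)"
        "\<forall>j. 0 \<le> v j" "\<forall>j. j \<notin> A \<longrightarrow> v j = 0" "sum v A = 1" "y = (\<Sum>j\<in>A. v j *\<^sub>R f j)"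
        by blast
      then show "s *\<^sub>R x + t *\<^sub>R y \<in> ?S" using st
        by (intro CollectI exI[of _ "\<lambda>j. s * u j + t * v j"])
           (auto simp: sum.distrib sum_distrib_left[symmetric] scaleR_sum_right scaleR_add_left)
    qed
  qed
  with assms(2) show ?thesis by blast
qed

section \<open>Lattice polytopes under sums, scaling and translation\<close>

lemma lattice_polytope_convex_hull:
  assumes "finite V" "V \<subseteq> integer_points"
  shows "lattice_polytope (convex hull V)"
  using assms unfolding lattice_polytope_def by blast

lemma lattice_polytope_plus:
  fixes Q R :: "(real ^ 'p::finite) set"
  assumes "lattice_polytope Q" "lattice_polytope R"
  shows "lattice_polytope (Q + R)"
proof -
  obtain V W where "finite V" "V \<subseteq> integer_points" "Q = convex hull V"
    and "finite W" "W \<subseteq> integer_points" "R = convex hull W"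
    using assms unfolding lattice_polytope_def by blast
  moreover have "V + W \<subseteq> integer_points" if "V \<subseteq> integer_points" "W \<subseteq> integer_points"
    using that by (fastforce simp: integer_points_def elim!: set_plus_elim)
  ultimately show ?thesis unfolding lattice_polytope_def
    by (intro exI[of _ "V + W"]) (simp add: convex_hull_set_plus finite_set_plus)
qed

lemma lattice_polytope_sum:
  fixes Q :: "'i \<Rightarrow> (real ^ 'p::finite) set"
  assumes "\<And>i. i \<in> I \<Longrightarrow> lattice_polytope (Q i)"
  shows "lattice_polytope (sum Q I)"
  using assms
proof (induction I rule: infinite_finite_induct)
  case (insert i I)
  then show ?case by (simp add: lattice_polytope_plus)
\<comment> \<open>The empty sum of sets is \<open>{0}\<close>, the hull of a single lattice point; a
  sum over an infinite index set has the same value by default.\<close>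
qed (use lattice_polytope_convex_hull[of "{0}"] in \<open>simp_all add: integer_points_def set_zero\<close>)

lemma lattice_polytope_scaleR:
  fixes Q :: "(real ^ 'p::finite) set"
  assumes "lattice_polytope Q"
  shows "lattice_polytope ((\<lambda>x. real n *\<^sub>R x) ` Q)"
proof -
  obtain V where "finite V" "V \<subseteq> integer_points" "Q = convex hull V"
    using assms unfolding lattice_polytope_def by blast
  then show ?thesis unfolding lattice_polytope_def
    by (intro exI[of _ "(\<lambda>x. real n *\<^sub>R x) ` V"])
       (auto simp: convex_hull_scaling integer_points_def)
qed

text \<open>Integer points of the \<open>k\<close>-fold dilate of the translate become integer
  points of the dilate of \<open>Q\<close> after adding \<open>k\<close> times \<open>w\<close>; a
  decomposition found there is shifted back by \<open>w\<close> in each summand.\<close>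

lemma normal_polytope_translate:
  fixes Q :: "(real ^ 'p::finite) set"
  assumes "normal_polytope Q" and w: "w \<in> integer_points"
  shows "normal_polytope ((\<lambda>x. x - w) ` Q)"
  unfolding normal_polytope_def
proof (intro conjI allI impI ballI)
  have hull: "convex hull ((\<lambda>x. x - w) ` A) = (\<lambda>x. x - w) ` (convex hull A)" for A :: "(real ^ 'p) set"
    using convex_hull_translation[of "- w" A] by simp
  have "lattice_polytope Q" using assms by (simp add: normal_polytope_def)
  then obtain V where "finite V" "V \<subseteq> integer_points" "Q = convex hull V"
    unfolding lattice_polytope_def by blast
  then show "lattice_polytope ((\<lambda>x. x - w) ` Q)" unfolding lattice_polytope_def
    using w
    by (intro exI[of _ "(\<lambda>x. x - w) ` V"])
       (auto simp: hull integer_points_def)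
next
  fix k :: nat and x
  assume "0 < k" and x: "x \<in> (*\<^sub>R) (real k) ` (\<lambda>x. x - w) ` Q \<inter> integer_points"
  then obtain q where q: "q \<in> Q" "x = real k *\<^sub>R (q - w)" by auto
  have "x + real k *\<^sub>R w \<in> (*\<^sub>R) (real k) ` Q"
    using q by (auto simp: algebra_simps)
  moreover have "x + real k *\<^sub>R w \<in> integer_points"
    using x w by (auto simp: integer_points_def)
  ultimately obtain y where y: "\<forall>i<k. y i \<in> Q \<inter> integer_points" "x + real k *\<^sub>R w = (\<Sum>i<k. y i)"
    using assms(1) \<open>0 < k\<close> unfolding normal_polytope_def by blast
  have "x = (\<Sum>i<k. y i - w)"
    using y(2) by (simp add: sum_subtractf scaleR_conv_of_real sum_constant_scaleR algebra_simps)
  moreover have "\<forall>i<k. y i - w \<in> (\<lambda>x. x - w) ` Q \<inter> integer_points"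
    using y(1) w by (auto simp: integer_points_def)
  ultimately show "\<exists>y. (\<forall>i<k. y i \<in> (\<lambda>x. x - w) ` Q \<inter> integer_points) \<and> x = (\<Sum>i<k. y i)"
    by (intro exI[of _ "\<lambda>i. y i - w"]) simp
qed

section \<open>The exchange relation for ideals\<close>

locale star_closed_orders =
  fixes lt lt' :: "'p::finite \<Rightarrow> 'p \<Rightarrow> bool" and Ps :: "'p set"
  assumes trans: "transp lt"
    and irrefl': "irreflp lt'"
    and trans': "transp lt'"
    and weaker: "\<And>p q. lt' p q \<Longrightarrow> lt p q"
    and star_closed: "\<And>J1 J2. J1 \<in> order_ideals lt UNIV \<Longrightarrow> J2 \<in> order_ideals lt UNIV \<Longrightarrow>
                        ideal_star lt' J1 J2 \<in> order_ideals lt UNIV"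
    and marked_maximal: "\<And>p q. p \<in> Ps \<Longrightarrow> \<not> lt' p q"
begin

abbreviation ideals :: "'p set set" where
  "ideals \<equiv> order_ideals lt UNIV"

definition max_vec :: "'p set \<Rightarrow> real ^ 'p" where
  "max_vec J = indicator_vec (maximal_elements lt' J)"

text \<open>An ideal for \<open>lt\<close> is also one for \<open>lt'\<close>, so whatever lies
  \<open>lt'\<close>-below a member of \<open>J\<close> is in \<open>J\<close>, and the maximal
  elements are a difference of two nested sets. This form leads to the recursion for
  \<open>f\<close> used for integrality.\<close>

lemma max_vec_nth:
  "max_vec J $ p = indicator J p - indicator {J. \<exists>q\<in>J. lt' p q} J" if "J \<in> ideals"
proof -
  have "p \<in> J" if "q \<in> J" "lt' p q" for q
    using that \<open>J \<in> ideals\<close> weaker unfolding order_ideals_def by blast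
  then show ?thesis
    by (auto simp: max_vec_def indicator_vec_def maximal_elements_def indicator_def)
qed

lemma max_vec_integer: "max_vec J \<in> integer_points"
  by (auto simp: max_vec_def indicator_vec_def integer_points_def indicator_def)

text \<open>Coordinatewise: if \<open>p\<close> lies \<open>lt'\<close>-below members of both
  ideals, all terms vanish. If it lies below members of \<open>J1\<close> only, then
  \<open>p \<in> J1\<close>, and both sides count whether \<open>p \<in> J2\<close>; symmetrically
  for \<open>J2\<close>. Otherwise both sides count the memberships of \<open>p\<close> in
  \<open>J1\<close> and \<open>J2\<close>.\<close>

lemma max_vec_Un_star:
  assumes "J1 \<in> ideals" "J2 \<in> ideals"
  shows "max_vec (J1 \<union> J2) + max_vec (ideal_star lt' J1 J2) = max_vec J1 + max_vec J2"
proof (subst vec_eq_iff, rule allI)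
  fix p
  have d: "p \<in> J" if "q \<in> J" "lt' p q" "J \<in> ideals" for q J
    using that weaker unfolding order_ideals_def by blast
  have U: "p \<in> maximal_elements lt' (J1 \<union> J2) \<longleftrightarrow>
      p \<in> J1 \<union> J2 \<and> \<not> (\<exists>q\<in>J1. lt' p q) \<and> \<not> (\<exists>q\<in>J2. lt' p q)"
    by (auto simp: maximal_elements_def)
  have M: "p \<in> maximal_elements lt' (ideal_star lt' J1 J2) \<longleftrightarrow>
      p \<in> J1 \<and> p \<in> J2 \<and> (\<not> (\<exists>q\<in>J1. lt' p q) \<or> \<not> (\<exists>q\<in>J2. lt' p q))"
    unfolding maximal_elements_ideal_star[OF trans'] by (auto simp: maximal_elements_def)
  have I1: "p \<in> maximal_elements lt' J1 \<longleftrightarrow> p \<in> J1 \<and> \<not> (\<exists>q\<in>J1. lt' p q)"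
    and I2: "p \<in> maximal_elements lt' J2 \<longleftrightarrow> p \<in> J2 \<and> \<not> (\<exists>q\<in>J2. lt' p q)"
    by (auto simp: maximal_elements_def)
  show "(max_vec (J1 \<union> J2) + max_vec (ideal_star lt' J1 J2)) $ p = (max_vec J1 + max_vec J2) $ p"
    using d[OF _ _ assms(1)] d[OF _ _ assms(2)]
    unfolding max_vec_def indicator_vec_def vector_add_component vec_lambda_beta indicator_def U M I1 I2
    by (cases "\<exists>q\<in>J1. lt' p q"; cases "\<exists>q\<in>J2. lt' p q") auto
qed

lemma ideal_star_subset:
  assumes "J1 \<in> ideals" "J2 \<in> ideals"
  shows "ideal_star lt' J1 J2 \<subseteq> J1 \<inter> J2"
  using assms weaker unfolding ideal_star_eq[OF trans'] order_ideals_def by blast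

text \<open>A marked element is \<open>lt'\<close>-maximal in every set that contains it, so the
  marked elements of \<open>J1 \<inter> J2\<close> are among the generators.\<close>

lemma ideal_star_marked:
  assumes "J1 \<in> ideals" "J2 \<in> ideals" 
  shows "ideal_star lt' J1 J2 \<inter> Ps = J1 \<inter> J2 \<inter> Ps"
proof
  show "ideal_star lt' J1 J2 \<inter> Ps \<subseteq> J1 \<inter> J2 \<inter> Ps"
    using ideal_star_subset[OF assms] by blast
  show "J1 \<inter> J2 \<inter> Ps \<subseteq> ideal_star lt' J1 J2 \<inter> Ps"
    using marked_maximal unfolding ideal_star_eq[OF trans'] maximal_elements_def by blast
qed

lemma ideals_Un: "J1 \<in> ideals \<Longrightarrow> J2 \<in> ideals \<Longrightarrow> J1 \<union> J2 \<in> ideals"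
  unfolding order_ideals_def by blast

section \<open>Real weights on ideals and reduction to a chain\<close>

text \<open>The weights are vectors indexed by the finite type of all subsets, so that compactness
  in Euclidean space is available. \<open>c\<close> prescribes the total weight of the ideals with a
  given trace on \<open>Ps\<close>.\<close>

definition ideal_weights :: "('p set \<Rightarrow> real) \<Rightarrow> real ^ 'p \<Rightarrow> (real ^ 'p set) set" where
  "ideal_weights c x = {a. (\<forall>J. 0 \<le> a $ J) \<and> (\<forall>J. J \<notin> ideals \<longrightarrow> a $ J = 0) \<and>
     (\<forall>K. (\<Sum>J | J \<inter> Ps = K. a $ J) = c K) \<and> (\<Sum>J\<in>UNIV. a $ J *\<^sub>R max_vec J) = x}"

lemma ideal_weights_le: "a \<in> ideal_weights c x \<Longrightarrow> a $ J \<le> c (J \<inter> Ps)"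
proof -
  assume "a \<in> ideal_weights c x"
  then have "\<forall>J. 0 \<le> a $ J" "c (J \<inter> Ps) = (\<Sum>J' | J' \<inter> Ps = J \<inter> Ps. a $ J')"
    unfolding ideal_weights_def by auto
  then show ?thesis using member_le_sum[of J "{J'. J' \<inter> Ps = J \<inter> Ps}" "($) a"] by auto
qed

lemma compact_ideal_weights: "compact (ideal_weights c x)"
proof -
  have "closed (ideal_weights c x)"
    \<comment> \<open>The premise \<open>J \<notin> ideals\<close> does not involve
      \<open>a\<close>; as a disjunction, the condition fits the rules for closed sets.\<close>
    unfolding ideal_weights_def imp_conv_disj
    by (intro closed_Collect_conj closed_Collect_all closed_Collect_disj closed_Collect_le
        closed_Collect_eq closed_Collect_const continuous_intros)
  moreover have "bounded (ideal_weights c x)"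
    unfolding bounded_iff
  proof (intro exI ballI)
    fix a assume a: "a \<in> ideal_weights c x"
    have "norm a \<le> (\<Sum>J\<in>UNIV. \<bar>a $ J\<bar>)" by (rule norm_le_l1_cart)
    also have "\<dots> \<le> (\<Sum>J\<in>UNIV. c (J \<inter> Ps))"
      using ideal_weights_le[OF a] a by (intro sum_mono) (auto simp: ideal_weights_def)
    finally show "norm a \<le> (\<Sum>J\<in>UNIV. c (J \<inter> Ps))" .
  qed
  ultimately show ?thesis by (simp add: compact_eq_bounded_closed)
qed

text \<open>By \<open>K\<close>, the star inherits the trace of \<open>J1\<close> and the union that
  of \<open>J2\<close>, so the totals on the traces stay fixed; \<open>max_vec_Un_star\<close> keeps
  the point fixed.\<close>

lemma ideal_weights_exchange:
  assumes a: "a \<in> ideal_weights c x" and e: "0 \<le> e" "e \<le> a $ J1" "e \<le> a $ J2"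
    and J: "J1 \<in> ideals" "J2 \<in> ideals" "J1 \<noteq> J2" and K: "J1 \<inter> Ps \<subseteq> J2 \<inter> Ps"
  shows "a + e *\<^sub>R (axis (J1 \<union> J2) 1 + axis (ideal_star lt' J1 J2) 1 - axis J1 1 - axis J2 1)
    \<in> ideal_weights c x" (is "?b \<in> _")
proof -
  let ?U = "J1 \<union> J2" and ?M = "ideal_star lt' J1 J2"
  let ?d = "axis ?U (1::real) + axis ?M 1 - axis J1 1 - axis J2 1"
  have S: "?M \<in> ideals" "?U \<in> ideals" using J star_closed ideals_Un by auto
  have tM: "?M \<inter> Ps = J1 \<inter> Ps" using ideal_star_marked[OF J(1,2)] K by blast
  have tU: "?U \<inter> Ps = J2 \<inter> Ps" using K by blast
  have nn: "0 \<le> ?b $ J" for J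
  proof -
    have "0 \<le> a $ J" using a by (auto simp: ideal_weights_def)
    \<comment> \<open>Since \<open>J1 \<noteq> J2\<close>, no coordinate loses more than
      \<open>e\<close>.\<close>
    moreover have "e * ?d $ J \<ge> - (if J = J1 \<or> J = J2 then e else 0)"
      using e(1) J(3) by (auto simp: axis_def)
    ultimately show ?thesis using e by (auto split: if_splits)
  qed
  have supp: "?b $ J = 0" if "J \<notin> ideals" for J
    using a that S J by (auto simp: ideal_weights_def axis_def)
  have type_sum: "(\<Sum>J | J \<inter> Ps = K. ?b $ J) = c K" for K
  proof -
    \<comment> \<open>The total on a trace is written as a linear functional with 0/1 coefficients,
      to which \<open>sum_exchange\<close> applies.\<close>
    have eq: "(\<Sum>J | J \<inter> Ps = K. b $ J) = (\<Sum>J\<in>UNIV. b $ J *\<^sub>R (if J \<inter> Ps = K then 1 else 0))"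
      for b :: "real ^ 'p set"
      by (rule sum.mono_neutral_cong_left) auto
    have "(\<Sum>J | J \<inter> Ps = K. a $ J) = c K" using a by (auto simp: ideal_weights_def)
    then show ?thesis unfolding eq sum_exchange tU tM by simp
  qed
  have "(\<Sum>J\<in>UNIV. ?b $ J *\<^sub>R max_vec J) = x"
    unfolding sum_exchange using max_vec_Un_star[OF J(1,2)] a by (auto simp: ideal_weights_def algebra_simps)
  with nn supp type_sum show ?thesis unfolding ideal_weights_def by blast
qed

text \<open>A maximizer of \<open>?phi\<close> exists by compactness. Two incomparable ideals in its
  support have comparable traces because \<open>c\<close> lives on a chain, so an exchange is
  possible, and it would increase \<open>?phi\<close>.\<close>

lemma ideal_weights_chain:
  assumes "ideal_weights c x \<noteq> {}" and ch: "chain\<^sub>\<subseteq> {K. c K \<noteq> 0}"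
  shows "\<exists>a\<in>ideal_weights c x. chain\<^sub>\<subseteq> {J. a $ J \<noteq> 0}"
proof -
  let ?phi = "\<lambda>a. \<Sum>J\<in>UNIV. a $ J *\<^sub>R (2::real) ^ card J"
  have "\<exists>a\<in>ideal_weights c x. \<forall>b\<in>ideal_weights c x. ?phi b \<le> ?phi a"
    by (rule continuous_attains_sup[OF compact_ideal_weights assms(1)]) (intro continuous_intros)
  then obtain a where a: "a \<in> ideal_weights c x"
    and max: "\<And>b. b \<in> ideal_weights c x \<Longrightarrow> ?phi b \<le> ?phi a" by blast
  have nn: "0 \<le> a $ J" for J using a by (auto simp: ideal_weights_def)
  have False if J: "a $ J1 \<noteq> 0" "a $ J2 \<noteq> 0" and inc: "\<not> J1 \<subseteq> J2" "\<not> J2 \<subseteq> J1"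
    and K: "J1 \<inter> Ps \<subseteq> J2 \<inter> Ps" for J1 J2
  proof -
    let ?U = "J1 \<union> J2" and ?M = "ideal_star lt' J1 J2"
    define e where "e = min (a $ J1) (a $ J2)"
    define b where "b = a + e *\<^sub>R (axis ?U 1 + axis ?M 1 - axis J1 1 - axis J2 1)"
    have e: "0 < e" "e \<le> a $ J1" "e \<le> a $ J2"
      using J nn[of J1] nn[of J2] unfolding e_def by auto
    have I: "J1 \<in> ideals" "J2 \<in> ideals" using J a by (auto simp: ideal_weights_def)
    have "b \<in> ideal_weights c x" unfolding b_def
      by (rule ideal_weights_exchange[OF a _ e(2,3) I _ K]) (use e inc in auto)
    from max[OF this] have le: "?phi b \<le> ?phi a" .
    have "?phi b = ?phi a + e * (2 ^ card ?U + 2 ^ card ?M - 2 ^ card J1 - 2 ^ card J2)"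
      unfolding b_def sum_exchange by simp
    then have "e * (2 ^ card ?U + 2 ^ card ?M - 2 ^ card J1 - 2 ^ card J2) \<le> (0::real)"
      using le by linarith
    then have "2 ^ card ?U + 2 ^ card ?M - 2 ^ card J1 - 2 ^ card J2 \<le> (0::real)"
      using e(1) by (simp add: mult_le_0_iff)
    \<comment> \<open>Both ideals are proper subsets of the union, so \<open>2 ^ card ?U\<close>
      alone outweighs or equals the sum of their two powers; the positive term of the star makes the
      gain strict.\<close>
    moreover have "2 * 2 ^ card J \<le> (2::real) ^ card ?U" if "J \<subset> ?U" for J
    proof -
      have "Suc (card J) \<le> card ?U" using psubset_card_mono[OF _ that] by (simp add: Suc_leI)
      then have "(2::real) ^ Suc (card J) \<le> 2 ^ card ?U" by (intro power_increasing) simp_all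
      then show ?thesis by simp
    qed
    from this[of J1] this[of J2] have "2 * 2 ^ card J1 \<le> (2::real) ^ card ?U" "2 * 2 ^ card J2 \<le> (2::real) ^ card ?U"
      using inc by blast+
    moreover have "(0::real) < 2 ^ card ?M" by simp
    ultimately show False by linarith
  qed
  note strict = this
  \<comment> \<open>The weight of \<open>J\<close> is bounded by the total on its trace, so the
    traces of the support belong to the chain \<open>ch\<close>.\<close>
  have "c (J \<inter> Ps) \<noteq> 0" if "a $ J \<noteq> 0" for J
    using ideal_weights_le[OF a, of J] nn[of J] that by linarith
  then have types: "J1 \<inter> Ps \<subseteq> J2 \<inter> Ps \<or> J2 \<inter> Ps \<subseteq> J1 \<inter> Ps" if "a $ J1 \<noteq> 0" "a $ J2 \<noteq> 0" for J1 J2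
    using ch[unfolded chain_subset_def, THEN bspec, THEN bspec, of "J1 \<inter> Ps" "J2 \<inter> Ps"] that by simp
  have "chain\<^sub>\<subseteq> {J. a $ J \<noteq> 0}"
    unfolding chain_subset_def
  proof (intro ballI, rule ccontr)
    fix J1 J2
    assume "J1 \<in> {J. a $ J \<noteq> 0}" "J2 \<in> {J. a $ J \<noteq> 0}" and "\<not> (J1 \<subseteq> J2 \<or> J2 \<subseteq> J1)"
    then have J: "a $ J1 \<noteq> 0" "a $ J2 \<noteq> 0" "\<not> J1 \<subseteq> J2" "\<not> J2 \<subseteq> J1" by simp_all
    from types[OF J(1,2)] show False
      using strict[OF J] strict[OF J(2,1,4,3)] by (rule disjE)
  qed
  with a show ?thesis by (rule bexI[rotated])
qed

section \<open>Integrality of weights supported on a chain\<close>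

text \<open>Integrality passes from \<open>x\<close> to \<open>f\<close> by induction down the order
  \<open>lt'\<close>, then from \<open>f\<close> to \<open>a\<close> by induction down the chain.
  The empty ideal contributes the zero vector and is invisible in \<open>x\<close>;
  \<open>c0\<close> forces its weight to be 0.\<close>

lemma ideal_weights_integer:
  assumes a: "a \<in> ideal_weights c x" and x: "x \<in> integer_points"
    and ch: "chain\<^sub>\<subseteq> {J. a $ J \<noteq> 0}" and c0: "c {} = 0"
  shows "a $ J \<in> \<int>"
proof -
  have nn: "0 \<le> a $ J" for J using a by (auto simp: ideal_weights_def)
  have cmp: "J1 \<subseteq> J2 \<or> J2 \<subseteq> J1" if "a $ J1 \<noteq> 0" "a $ J2 \<noteq> 0" for J1 J2
    using ch that unfolding chain_subset_def by simp
  define f where "f p = (\<Sum>J | p \<in> J. a $ J)" for p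
  define g where "g p = (\<Sum>J | \<exists>q\<in>J. lt' p q. a $ J)" for p
  have xfg: "f p = x $ p + g p" for p
  proof -
    have "x $ p = (\<Sum>J\<in>UNIV. a $ J * max_vec J $ p)"
      using a by (auto simp: ideal_weights_def)
    also have "\<dots> = (\<Sum>J\<in>UNIV. a $ J * (indicator J p - indicator {J. \<exists>q\<in>J. lt' p q} J))"
    proof (rule sum.cong[OF refl])
      fix J
      \<comment> \<open>The formula for \<open>max_vec\<close> holds for ideals; all other sets have
        weight 0.\<close>
      show "a $ J * max_vec J $ p = a $ J * (indicator J p - indicator {J. \<exists>q\<in>J. lt' p q} J)"
        using a by (cases "J \<in> ideals") (auto simp: ideal_weights_def max_vec_nth)
    qed
    also have "\<dots> = (\<Sum>J\<in>UNIV. if p \<in> J then a $ J else 0) -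
        (\<Sum>J\<in>UNIV. if \<exists>q\<in>J. lt' p q then a $ J else 0)"
      unfolding sum_subtractf[symmetric] by (intro sum.cong) (auto simp: indicator_def)
    also have "\<dots> = f p - g p"
      unfolding f_def g_def by (simp add: sum.If_cases)
    finally show ?thesis by simp
  qed
  text \<open>The members of the support that meet \<open>{q. lt' p q}\<close> form an up-set of the chain, so they are
    the members that contain one fixed \<open>q\<close> from the smallest of them.\<close>
  have gf: "g p = 0 \<or> (\<exists>q. lt' p q \<and> g p = f q)" for p
  proof (cases "{J. a $ J \<noteq> 0 \<and> (\<exists>q\<in>J. lt' p q)} = {}")
    case True
    then have "g p = 0" unfolding g_def by (intro sum.neutral) auto
    then show ?thesis ..
  next
    case False
    from finite_has_minimal[OF _ this] obtain J0 where J0: "a $ J0 \<noteq> 0" "\<exists>q\<in>J0. lt' p q"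
      and min: "\<And>J. a $ J \<noteq> 0 \<Longrightarrow> \<exists>q\<in>J. lt' p q \<Longrightarrow> J \<subseteq> J0 \<Longrightarrow> J0 = J" by auto
    then obtain q where q: "q \<in> J0" "lt' p q" by blast
    have iff: "(\<exists>r\<in>J. lt' p r) \<longleftrightarrow> q \<in> J" if "a $ J \<noteq> 0" for J
      using cmp[OF that J0(1)] min[OF that] q by blast
    have "g p = (\<Sum>J | a $ J \<noteq> 0 \<and> (\<exists>r\<in>J. lt' p r). a $ J)"
      unfolding g_def by (intro sum.mono_neutral_right) auto
    also have "{J. a $ J \<noteq> 0 \<and> (\<exists>r\<in>J. lt' p r)} = {J. a $ J \<noteq> 0 \<and> q \<in> J}"
      using iff by auto
    also have "(\<Sum>J\<in>\<dots>. a $ J) = f q"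
      unfolding f_def by (intro sum.mono_neutral_left) auto
    finally show ?thesis using q(2) by blast
  qed
  \<comment> \<open>By \<open>gf\<close>, \<open>g p\<close> is 0 or a value of \<open>f\<close>
    strictly above \<open>p\<close>, where fewer elements remain above.\<close>
  have f_int: "f p \<in> \<int>" for p
  proof (induction "card {r. lt' p r}" arbitrary: p rule: less_induct)
    case less
    have "f q \<in> \<int>" if "lt' p q" for q
    proof (rule less)
      have "{r. lt' q r} \<subset> {r. lt' p r}"
        using that transpD[OF trans'] irreflpD[OF irrefl'] by blast
      then show "card {r. lt' q r} < card {r. lt' p r}" by (intro psubset_card_mono) auto
    qed
    then have "g p \<in> \<int>" using gf[of p] by auto
    moreover have "x $ p \<in> \<int>" using x by (auto simp: integer_points_def)
    ultimately show ?case unfolding xfg by auto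
  qed
  show ?thesis
  proof (induction "card (- J)" arbitrary: J rule: less_induct)
    case less
    show ?case
    proof (cases "a $ J = 0 \<or> J = {}")
      case True
      then show ?thesis using ideal_weights_le[OF a, of "{}"] nn[of "{}"] c0 by auto
    next
      case False
      then have J: "a $ J \<noteq> 0" "J \<noteq> {}" by auto
      \<comment> \<open>Take \<open>p\<close> in \<open>J\<close> outside the largest support member
        properly inside \<open>J\<close>. Then \<open>f p\<close> sums exactly the weights of the
        support members containing \<open>J\<close>, and those larger than \<open>J\<close> are
        covered by the induction.\<close>
      have "\<exists>p\<in>J. \<forall>J'. a $ J' \<noteq> 0 \<longrightarrow> J' \<subset> J \<longrightarrow> p \<notin> J'"
      proof (cases "{J'. a $ J' \<noteq> 0 \<and> J' \<subset> J} = {}")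
        case True
        with J show ?thesis by blast
      next
        case False
        from finite_has_maximal[OF _ this] obtain J1 where J1: "a $ J1 \<noteq> 0" "J1 \<subset> J"
          and max: "\<And>J'. a $ J' \<noteq> 0 \<Longrightarrow> J' \<subset> J \<Longrightarrow> J1 \<subseteq> J' \<Longrightarrow> J1 = J'" by auto
        have "J' \<subseteq> J1" if "a $ J' \<noteq> 0" "J' \<subset> J" for J'
          using cmp[OF that(1) J1(1)] max[OF that] by blast
        with J1(2) show ?thesis by blast
      qed
      then obtain p where p: "p \<in> J" and small: "\<And>J'. a $ J' \<noteq> 0 \<Longrightarrow> J' \<subset> J \<Longrightarrow> p \<notin> J'"
        by blast
      have "f p = (\<Sum>J' | J \<subseteq> J'. a $ J')"
        unfolding f_def
      proof (rule sum.mono_neutral_right)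
        show "\<forall>J'\<in>{J'. p \<in> J'} - {J'. J \<subseteq> J'}. a $ J' = 0"
          using cmp[OF J(1)] small by blast
      qed (use p in auto)
      also have "{J'. J \<subseteq> J'} = insert J {J'. J \<subset> J'}" by auto
      also have "(\<Sum>J'\<in>\<dots>. a $ J') = a $ J + (\<Sum>J' | J \<subset> J'. a $ J')"
        by (rule sum.insert) auto
      finally have "a $ J = f p - (\<Sum>J' | J \<subset> J'. a $ J')" by simp
      moreover have "(\<Sum>J' | J \<subset> J'. a $ J') \<in> \<int>"
      proof (rule Ints_sum)
        fix J' assume "J' \<in> {J'. J \<subset> J'}"
        then have "card (- J') < card (- J)" by (intro psubset_card_mono) auto
        then show "a $ J' \<in> \<int>" by (rule less)
      qed
      ultimately show ?thesis using f_int[of p] by auto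
    qed
  qed
qed

section \<open>Multisets of ideals and their division\<close>

text \<open>The counterpart of \<open>ideal_weights\<close> over the naturals: multisets of ideals,
  given by their multiplicities.\<close>

definition ideal_multiplicities :: "('p set \<Rightarrow> nat) \<Rightarrow> real ^ 'p \<Rightarrow> ('p set \<Rightarrow> nat) set" where
  "ideal_multiplicities c x = {n. (\<forall>J. J \<notin> ideals \<longrightarrow> n J = 0) \<and>
     (\<forall>K. (\<Sum>J | J \<inter> Ps = K. n J) = c K) \<and> (\<Sum>J\<in>UNIV. real (n J) *\<^sub>R max_vec J) = x}"

text \<open>Weights supported on a chain exist by \<open>ideal_weights_chain\<close>; for an integer
  point they are integers, and being nonnegative they are multiplicities.\<close>

lemma ideal_multiplicities_nonempty:
  assumes "ideal_weights (\<lambda>K. real (c K)) x \<noteq> {}" and "x \<in> integer_points"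
    and "chain\<^sub>\<subseteq> {K. c K \<noteq> 0}" and "c {} = 0"
  shows "ideal_multiplicities c x \<noteq> {}"
proof -
  have "chain\<^sub>\<subseteq> {K. real (c K) \<noteq> 0}" using assms(3) by simp
  from ideal_weights_chain[OF assms(1) this] obtain a
    where a: "a \<in> ideal_weights (\<lambda>K. real (c K)) x" and ch: "chain\<^sub>\<subseteq> {J. a $ J \<noteq> 0}" by blast
  have "a $ J \<in> \<nat>" for J
    using ideal_weights_integer[OF a assms(2) ch, of J] assms(4) a
    by (auto simp: Nats_altdef2 ideal_weights_def)
  then obtain n where n: "\<And>J. a $ J = real (n J)" unfolding Nats_def image_def by simp metis
  have "(\<Sum>J | J \<inter> Ps = K. n J) = c K" for K
  proof -
    have "real (\<Sum>J | J \<inter> Ps = K. n J) = real (c K)"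
      using a by (simp add: ideal_weights_def n)
    then show ?thesis by (simp only: of_nat_eq_iff)
  qed
  then have "n \<in> ideal_multiplicities c x"
    using a by (auto simp: ideal_weights_def ideal_multiplicities_def n)
  then show ?thesis by blast
qed

text \<open>From the ideals of each trace \<open>K\<close> split off any \<open>c K\<close> of them;
  the remainder meets the requirement for one part fewer.\<close>

lemma ideal_multiplicities_split:
  assumes "n \<in> ideal_multiplicities (\<lambda>K. k * c K) x"
  shows "\<exists>y. (\<forall>i<k. ideal_multiplicities c (y i) \<noteq> {}) \<and> x = (\<Sum>i<k. y i)"
  using assms
proof (induction k arbitrary: n x)
  case 0
  then have "\<And>K. (\<Sum>J | J \<inter> Ps = K. n J) = 0" by (simp add: ideal_multiplicities_def)
  then have "n J = 0" for J by simp
  with 0 show ?case by (simp add: ideal_multiplicities_def)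
next
  case (Suc k)
  from Suc.prems have supp: "\<And>J. J \<notin> ideals \<Longrightarrow> n J = 0"
    and tot: "\<And>K. (\<Sum>J | J \<inter> Ps = K. n J) = Suc k * c K"
    and x: "x = (\<Sum>J\<in>UNIV. real (n J) *\<^sub>R max_vec J)"
    by (auto simp: ideal_multiplicities_def)
  have "\<exists>b. (\<forall>J. b J \<le> n J) \<and> (\<Sum>J | J \<inter> Ps = K. b J) = c K" for K
    by (rule exists_subweight) (simp_all add: tot)
  then obtain b where b: "\<And>K J. b K J \<le> n J" "\<And>K. (\<Sum>J | J \<inter> Ps = K. b K J) = c K" by metis
  \<comment> \<open>The selections for the different traces are glued together: every
    \<open>J\<close> has exactly one trace.\<close>
  define m where "m J = b (J \<inter> Ps) J" for J
  have mn: "m J \<le> n J" for J using b by (simp add: m_def)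
  have mtot: "(\<Sum>J | J \<inter> Ps = K. m J) = c K" for K
    unfolding b(2)[of K, symmetric] m_def by (intro sum.cong) auto
  define y where "y = (\<Sum>J\<in>UNIV. real (m J) *\<^sub>R max_vec J)"
  have "m J = 0" if "J \<notin> ideals" for J using mn[of J] supp[OF that] by simp
  then have y: "m \<in> ideal_multiplicities c y"
    using mtot by (simp add: ideal_multiplicities_def y_def)
  have "(\<lambda>J. n J - m J) \<in> ideal_multiplicities (\<lambda>K. k * c K) (x - y)"
    unfolding ideal_multiplicities_def
  proof (intro CollectI conjI allI impI)
    fix K
    show "(\<Sum>J | J \<inter> Ps = K. n J - m J) = k * c K"
      using sum_subtractf_nat[of "{J. J \<inter> Ps = K}" m n] mn by (simp add: tot mtot)
  next
    show "(\<Sum>J\<in>UNIV. real (n J - m J) *\<^sub>R max_vec J) = x - y"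
      using mn by (simp add: x y_def sum_subtractf of_nat_diff algebra_simps)
  qed (simp add: supp)
  from Suc.IH[OF this] obtain z where z: "\<forall>i<k. ideal_multiplicities c (z i) \<noteq> {}" "x - y = (\<Sum>i<k. z i)"
    by blast
  have "x = (\<Sum>i<Suc k. (z(k := y)) i)"
    using z(2) by (simp add: algebra_simps)
  moreover have "\<forall>i<Suc k. ideal_multiplicities c ((z(k := y)) i) \<noteq> {}"
    using z(1) y by (auto simp: less_Suc_eq)
  ultimately show ?case by blast
qed

lemma ideal_multiplicities_integer: "n \<in> ideal_multiplicities c x \<Longrightarrow> x \<in> integer_points"
  using max_vec_integer
  by (auto simp: ideal_multiplicities_def integer_points_def intro!: Ints_sum Ints_mult)

section \<open>Points of the Minkowski sum as combinations of ideals\<close>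

abbreviation fiber :: "'p set \<Rightarrow> 'p set set" where
  "fiber K \<equiv> {J \<in> ideals. J \<inter> Ps = K}"

lemma fundamental_polytope_eq:
  "fundamental_polytope lt lt' Ps K = convex hull (max_vec ` fiber K)"
  unfolding fundamental_polytope_def max_vec_def by (simp add: setcompr_eq_image)

text \<open>The \<open>lt\<close>-lower closure of \<open>K\<close> in the whole poset has trace
  \<open>K\<close>. Nonempty fibers ensure that a summand with coefficient 0 is \<open>{0}\<close>
  and not the empty set.\<close>

lemma fiber_nonempty:
  assumes "K \<in> order_ideals lt Ps"
  shows "fiber K \<noteq> {}"
proof -
  let ?J = "{p. \<exists>q\<in>K. p = q \<or> lt p q}"
  have "?J \<in> ideals" using transpD[OF trans] unfolding order_ideals_def by blast
  moreover have "?J \<inter> Ps = K" using assms unfolding order_ideals_def by blast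
  ultimately show ?thesis by blast
qed

text \<open>The formula of \<open>nonneg_relative_polytope\<close> with free coefficients in place
  of those of the chain expansion.\<close>

definition minkowski_polytope :: "('p set \<Rightarrow> nat) \<Rightarrow> (real ^ 'p) set" where
  "minkowski_polytope c =
     (\<Sum>K\<in>order_ideals lt Ps. (\<lambda>x. real (c K) *\<^sub>R x) ` fundamental_polytope lt lt' Ps K)"

lemma sum_over_fibers:
  "(\<Sum>K\<in>order_ideals lt Ps. \<Sum>J\<in>fiber K. h J) = sum h ideals"
  by (rule sum.group) (auto simp: order_ideals_def)

text \<open>Group the multiset by traces: the \<open>c K\<close> ideals of trace \<open>K\<close>
  sum to \<open>c K\<close> times their average, which lies in the fundamental polytope of
  \<open>K\<close>.\<close>

lemma ideal_multiplicities_mem: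
  assumes "n \<in> ideal_multiplicities c x"
  shows "x \<in> minkowski_polytope c"
proof -
  define s where "s K = (\<Sum>J\<in>fiber K. real (n J) *\<^sub>R max_vec J)" for K
  have supp: "\<And>J. J \<notin> ideals \<Longrightarrow> n J = 0"
    and tot: "\<And>K. (\<Sum>J | J \<inter> Ps = K. n J) = c K"
    and x: "x = (\<Sum>J\<in>UNIV. real (n J) *\<^sub>R max_vec J)"
    using assms by (auto simp: ideal_multiplicities_def)
  have tot': "(\<Sum>J\<in>fiber K. n J) = c K" for K
  proof -
    have "\<forall>J\<in>{J. J \<inter> Ps = K} - fiber K. n J = 0" using supp by blast
    then show ?thesis unfolding tot[symmetric] by (intro sum.mono_neutral_left) auto
  qed
  have "x = (\<Sum>J\<in>ideals. real (n J) *\<^sub>R max_vec J)"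
    unfolding x by (rule sum.mono_neutral_right) (auto simp: supp)
  also have "\<dots> = sum s (order_ideals lt Ps)"
    unfolding s_def by (rule sum_over_fibers[symmetric])
  finally have "x = sum s (order_ideals lt Ps)" .
  moreover have "s K \<in> (\<lambda>x. real (c K) *\<^sub>R x) ` fundamental_polytope lt lt' Ps K"
    if K: "K \<in> order_ideals lt Ps" for K
  proof (cases "c K = 0")
    case True
    then have "s K = 0" using tot'[of K] by (simp add: s_def)
    moreover have "fundamental_polytope lt lt' Ps K \<noteq> {}"
      using fiber_nonempty[OF K] unfolding fundamental_polytope_eq convex_hull_eq_empty by simp
    ultimately show ?thesis using True by (simp add: image_constant_conv)
  next
    case False
    let ?z = "\<Sum>J\<in>fiber K. (real (n J) / real (c K)) *\<^sub>R max_vec J"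
    have "?z \<in> fundamental_polytope lt lt' Ps K"
      unfolding fundamental_polytope_eq
    proof (rule convex_sum)
      have "(\<Sum>J\<in>fiber K. real (n J)) = real (c K)"
        unfolding tot'[of K, symmetric] by simp
      then show "(\<Sum>J\<in>fiber K. real (n J) / real (c K)) = 1"
        using False by (simp add: sum_divide_distrib[symmetric])
    qed (auto intro: hull_inc)
    moreover have "s K = real (c K) *\<^sub>R ?z"
      using False by (simp add: s_def scaleR_sum_right)
    ultimately show ?thesis by blast
  qed
  ultimately show ?thesis unfolding minkowski_polytope_def by (subst set_sum_alt) auto
qed

text \<open>Barycentric coordinates of the summand for \<open>K\<close>, multiplied by
  \<open>k * c K\<close>, serve as weights on the fiber of \<open>K\<close>.\<close>

lemma minkowski_polytope_weights:
  assumes x: "x \<in> minkowski_polytope c" and c: "\<And>K. c K \<noteq> 0 \<Longrightarrow> K \<in> order_ideals lt Ps"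
  shows "ideal_weights (\<lambda>K. real (k * c K)) (real k *\<^sub>R x) \<noteq> {}"
proof -
  obtain s where s: "x = sum s (order_ideals lt Ps)"
    and sK: "\<And>K. K \<in> order_ideals lt Ps \<Longrightarrow> s K \<in> (\<lambda>x. real (c K) *\<^sub>R x) ` fundamental_polytope lt lt' Ps K"
    using x unfolding minkowski_polytope_def by (subst (asm) set_sum_alt) auto
  have "\<exists>u. (\<forall>J. 0 \<le> u J) \<and> sum u (fiber K) = (1::real) \<and>
      s K = (\<Sum>J\<in>fiber K. (real (c K) * u J) *\<^sub>R max_vec J)" if K: "K \<in> order_ideals lt Ps" for K
  proof -
    obtain z where z: "z \<in> convex hull (max_vec ` fiber K)" "s K = real (c K) *\<^sub>R z"
      using sK[OF K] unfolding fundamental_polytope_eq by blast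
    from convex_hull_image_weights[OF _ z(1)] obtain u
      where "\<forall>J. 0 \<le> u J" "sum u (fiber K) = (1::real)" "z = (\<Sum>J\<in>fiber K. u J *\<^sub>R max_vec J)"
      by auto
    with z(2) show ?thesis by (intro exI[of _ u]) (simp add: scaleR_sum_right)
  qed
  then have "\<forall>K\<in>order_ideals lt Ps. \<exists>u. (\<forall>J. 0 \<le> u J) \<and> sum u (fiber K) = (1::real) \<and>
      s K = (\<Sum>J\<in>fiber K. (real (c K) * u J) *\<^sub>R max_vec J)" by (rule ballI)
  from bchoice[OF this] obtain u where "\<forall>K\<in>order_ideals lt Ps. (\<forall>J. 0 \<le> u K J) \<and>
      sum (u K) (fiber K) = (1::real) \<and> s K = (\<Sum>J\<in>fiber K. (real (c K) * u K J) *\<^sub>R max_vec J)" ..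
  then have u: "\<And>K J. K \<in> order_ideals lt Ps \<Longrightarrow> 0 \<le> u K J"
    "\<And>K. K \<in> order_ideals lt Ps \<Longrightarrow> sum (u K) (fiber K) = 1"
    "\<And>K. K \<in> order_ideals lt Ps \<Longrightarrow> s K = (\<Sum>J\<in>fiber K. (real (c K) * u K J) *\<^sub>R max_vec J)"
    by simp_all
  \<comment> \<open>Each ideal takes its coordinate from the summand of its own trace; other sets
    get 0.\<close>
  define b where "b J = (if J \<in> ideals then real k * real (c (J \<inter> Ps)) * u (J \<inter> Ps) J else 0)" for J
  have tr: "J \<inter> Ps \<in> order_ideals lt Ps" if "J \<in> ideals" for J
    using that by (auto simp: order_ideals_def)
  have "(\<chi> J. b J) \<in> ideal_weights (\<lambda>K. real (k * c K)) (real k *\<^sub>R x)"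
    unfolding ideal_weights_def
  proof (intro CollectI conjI allI impI)
    fix J
    show "0 \<le> (\<chi> J. b J) $ J" using u(1) tr by (auto simp: b_def)
    show "(\<chi> J. b J) $ J = 0" if "J \<notin> ideals" using that by (simp add: b_def)
  next
    fix K
    have "(\<Sum>J | J \<inter> Ps = K. b J) = (\<Sum>J\<in>fiber K. b J)"
      by (rule sum.mono_neutral_right) (auto simp: b_def)
    also have "\<dots> = real k * real (c K) * sum (u K) (fiber K)"
      unfolding sum_distrib_left by (intro sum.cong) (auto simp: b_def)
    \<comment> \<open>If \<open>c K = 0\<close>, both sides vanish; otherwise \<open>K\<close> is an
      ideal of \<open>Ps\<close> and its coordinates sum to 1.\<close>
    also have "\<dots> = real (k * c K)"
      using c u(2) by (cases "c K = 0") auto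
    finally show "(\<Sum>J | J \<inter> Ps = K. (\<chi> J. b J) $ J) = real (k * c K)" by simp
  next
    have "(\<Sum>J\<in>UNIV. b J *\<^sub>R max_vec J) = (\<Sum>J\<in>ideals. b J *\<^sub>R max_vec J)"
      by (rule sum.mono_neutral_right) (auto simp: b_def)
    also have "\<dots> = (\<Sum>K\<in>order_ideals lt Ps. \<Sum>J\<in>fiber K. b J *\<^sub>R max_vec J)"
      by (rule sum_over_fibers[symmetric])
    also have "\<dots> = (\<Sum>K\<in>order_ideals lt Ps. real k *\<^sub>R s K)"
    proof (rule sum.cong[OF refl])
      fix K assume K: "K \<in> order_ideals lt Ps"
      show "(\<Sum>J\<in>fiber K. b J *\<^sub>R max_vec J) = real k *\<^sub>R s K"
        unfolding u(3)[OF K] scaleR_sum_right by (intro sum.cong) (auto simp: b_def)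
    qed
    also have "\<dots> = real k *\<^sub>R x" by (simp add: s scaleR_sum_right)
    finally show "(\<Sum>J\<in>UNIV. (\<chi> J. b J) $ J *\<^sub>R max_vec J) = real k *\<^sub>R x" by simp
  qed
  then show ?thesis by blast
qed

section \<open>Normality\<close>

text \<open>An integer point of the \<open>k\<close>-fold dilate has weights with totals
  \<open>k * c K\<close>, hence multiplicities with these totals. Dividing the multiset into
  \<open>k\<close> parts gives \<open>k\<close> integer points of the polytope.\<close>

lemma normal_minkowski_polytope:
  assumes c: "\<And>K. c K \<noteq> 0 \<Longrightarrow> K \<in> order_ideals lt Ps"
    and ch: "chain\<^sub>\<subseteq> {K. c K \<noteq> 0}" and c0: "c {} = 0"
  shows "normal_polytope (minkowski_polytope c)"
  unfolding normal_polytope_def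
proof (intro conjI allI impI ballI)
  have "lattice_polytope (fundamental_polytope lt lt' Ps K)" for K
    unfolding fundamental_polytope_eq
    by (rule lattice_polytope_convex_hull) (auto simp: max_vec_integer)
  then show "lattice_polytope (minkowski_polytope c)"
    unfolding minkowski_polytope_def by (intro lattice_polytope_sum lattice_polytope_scaleR)
next
  fix k :: nat and x
  assume k: "0 < k" and x: "x \<in> (*\<^sub>R) (real k) ` minkowski_polytope c \<inter> integer_points"
  then have w: "ideal_weights (\<lambda>K. real (k * c K)) x \<noteq> {}"
    using minkowski_polytope_weights[OF _ c, where k = k] by blast
  have "chain\<^sub>\<subseteq> {K. k * c K \<noteq> 0}" using ch k by simp
  from ideal_multiplicities_nonempty[OF w _ this] obtain n
    where "n \<in> ideal_multiplicities (\<lambda>K. k * c K) x" using x c0 by auto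
  from ideal_multiplicities_split[OF this] obtain y
    where y: "\<And>i. i < k \<Longrightarrow> ideal_multiplicities c (y i) \<noteq> {}" "x = (\<Sum>i<k. y i)" by blast
  have "y i \<in> minkowski_polytope c \<inter> integer_points" if "i < k" for i
    using y(1)[OF that] ideal_multiplicities_mem ideal_multiplicities_integer by blast
  with y(2) show "\<exists>y. (\<forall>i<k. y i \<in> minkowski_polytope c \<inter> integer_points) \<and> x = (\<Sum>i<k. y i)"
    by blast
qed

end

text \<open>The shifted marking is dominant and nonnegative, so its chain expansion supplies
  coefficients for \<open>normal_minkowski_polytope\<close>; undoing the shift is a translation by
  an integer vector.\<close>

theorem corollary3p1p10:
  fixes lt lt' :: "'p::finite \<Rightarrow> 'p \<Rightarrow> bool"
    and Ps :: "'p set"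
    and lam :: "'p \<Rightarrow> int"
  assumes order: "irreflp lt" "transp lt"
    and minimal_marked: "\<And>p. \<not> (\<exists>q. lt q p) \<Longrightarrow> p \<in> Ps"
    and maximal_marked: "\<And>p. \<not> (\<exists>q. lt p q) \<Longrightarrow> p \<in> Ps"
    and dominant: "dominant lt Ps lam"
    and order': "irreflp lt'" "transp lt'"
    and weaker: "\<And>p q. lt' p q \<Longrightarrow> lt p q"
    and star_closed: "\<And>J1 J2. J1 \<in> order_ideals lt UNIV \<Longrightarrow> J2 \<in> order_ideals lt UNIV \<Longrightarrow>
                        ideal_star lt' J1 J2 \<in> order_ideals lt UNIV"
    and marked_maximal: "\<And>p q. p \<in> Ps \<Longrightarrow> \<not> lt' p q"
  shows "normal_polytope (relative_polytope lt lt' Ps lam)"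
proof -
  interpret star_closed_orders lt lt' Ps
    by unfold_locales (fact order(2) order' weaker star_closed marked_maximal)+
  define \<beta> where "\<beta> = (SOME \<beta>. \<forall>p\<in>Ps. lam p + \<beta> \<ge> 0)"
  \<comment> \<open>An explicit admissible shift shows that the choice defining
    \<open>\<beta>\<close> is admissible too.\<close>
  have "\<forall>p\<in>Ps. lam p + (\<Sum>q\<in>Ps. \<bar>lam q\<bar>) \<ge> 0"
  proof
    fix p assume "p \<in> Ps"
    then have "\<bar>lam p\<bar> \<le> (\<Sum>q\<in>Ps. \<bar>lam q\<bar>)" by (intro member_le_sum) auto
    then show "lam p + (\<Sum>q\<in>Ps. \<bar>lam q\<bar>) \<ge> 0" by linarith
  qed
  then have nonneg: "\<forall>p\<in>Ps. lam p + \<beta> \<ge> 0" unfolding \<beta>_def by (rule someI)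
  have dom: "dominant lt Ps (\<lambda>p. lam p + \<beta>)" using dominant by (simp add: dominant_def)
  let ?c = "chain_coeff lt Ps (\<lambda>p. lam p + \<beta>)"
  have "is_chain_expansion lt Ps (\<lambda>p. lam p + \<beta>) ?c"
    unfolding chain_coeff_def by (rule theI'[OF chain_expansion_ex1[OF dom nonneg]])
  then have "normal_polytope (minkowski_polytope ?c)"
    by (intro normal_minkowski_polytope) (auto simp: is_chain_expansion_def)
  moreover have "of_int \<beta> *\<^sub>R indicator_vec (maximal_elements lt' UNIV) \<in> (integer_points :: (real ^ 'p) set)"
    using max_vec_integer[of UNIV] by (auto simp: integer_points_def max_vec_def)
  ultimately show ?thesis
    unfolding relative_polytope_def Let_def nonneg_relative_polytope_def \<beta>_def[symmetric]
      minkowski_polytope_def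
    by (rule normal_polytope_translate)
qed

end
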